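(* Let $G$ be a connected graph of order $n$ with distances $d_{rt}=d_G(v_r,v_t)$, and let $T=\sum_{r<t}(1-2d_{rt})^2$. Then $$\sqrt{2T+n(n-1)\,|\det(\mathcal{D}^S(G))|^{2/n}}\le E_{\mathcal{D}^S}(G)\le\sqrt{2nT}.$$
   Context: The distance Seidel matrix of a connected graph $G$ is $\mathcal{D}^S(G)=J-I-2\mathcal{D}(G)$, where $\mathcal{D}(G)=(d_{rt})$ is the distance matrix and $J$ the all-ones matrix. The distance Seidel energy is $E_{\mathcal{D}^S}(G)=\sum_{r=1}^n|\partial_r^S|$, the sum of the absolute values of the eigenvalues of $\mathcal{D}^S(G)$. *)

theory Defs
  imports
    "Graph_Theory.Graph_Theory"
    "Jordan_Normal_Form.Spectral_Radius"
begin

text \<open>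
  A finite simple graph is an instance of the locale graph of Graph_Theory: a finite symmetric
  digraph without loops or parallel arcs, each edge being a pair of opposite arcs. Its connectedness
  predicate excludes the graph without vertices.
\<close>

text \<open>The least length of a walk, as the shortest-path function for unit arc weights. It is a real
  conversion of an extended real, hence meaningful only for vertices joined by a walk.\<close>

definition graph_dist :: "('a, 'b) pre_digraph \<Rightarrow> 'a \<Rightarrow> 'a \<Rightarrow> real" where
  "graph_dist G u w = real_of_ereal (wf_digraph.\<mu> G (\<lambda>_. 1) u w)"

text \<open>Matrices are indexed from 0, with respect to an enumeration v of the vertices by 0, ..., n - 1.\<close>

definition distance_matrix :: "('a, 'b) pre_digraph \<Rightarrow> nat \<Rightarrow> (nat \<Rightarrow> 'a) \<Rightarrow> real mat" where
  "distance_matrix G n v = mat n n (\<lambda>(r, t). graph_dist G (v r) (v t))"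

definition all_ones_matrix :: "nat \<Rightarrow> real mat" where
  "all_ones_matrix n = mat n n (\<lambda>_. 1)"

definition distance_Seidel_matrix :: "('a, 'b) pre_digraph \<Rightarrow> nat \<Rightarrow> (nat \<Rightarrow> 'a) \<Rightarrow> real mat" where
  "distance_Seidel_matrix G n v =
     all_ones_matrix n - 1\<^sub>m n - 2 \<cdot>\<^sub>m distance_matrix G n v"

text \<open>The sum of the absolute values of all complex eigenvalues of a real matrix, each counted with its
  algebraic multiplicity. For a symmetric matrix these eigenvalues are real.\<close>

definition matrix_energy :: "real mat \<Rightarrow> real" where
  "matrix_energy A =
     (let B = map_mat complex_of_real A
      in \<Sum>k\<in>spectrum B. real (order k (char_poly B)) * cmod k)"

definition distance_Seidel_energy :: "('a, 'b) pre_digraph \<Rightarrow> nat \<Rightarrow> (nat \<Rightarrow> 'a) \<Rightarrow> real" where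
  "distance_Seidel_energy G n v = matrix_energy (distance_Seidel_matrix G n v)"

end

theory Submission
  imports Defs "HOL-Analysis.Convex"
begin

text \<open>
  The matrix is real and symmetric, so its eigenvalues are real and the sum of their squares is the
  trace of its square, which is 2T. The upper bound is the Cauchy-Schwarz inequality. The square
  of the energy exceeds 2T by the sum of the products of absolute values over all ordered pairs of
  different positions in the list of eigenvalues. Each eigenvalue occurs in 2(n - 1) of these n(n - 1) products,
  so by the AM-GM inequality their mean is at least the absolute determinant to the power 2/n.
\<close>

section \<open>Distances\<close>

text \<open>Symmetry supplies an opposite for every arc; the opposites, taken in reverse order, form
  the walk back.\<close>

lemma (in sym_digraph) reverse_awalk:
  assumes "awalk u p w"
  shows "\<exists>q. awalk w q u \<and> length q = length p"
  using assms
proof (induct p arbitrary: u)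
  case Nil
  then show ?case by (auto simp: awalk_Nil_iff)
next
  case (Cons e p)
  then have e: "e \<in> arcs G" "u = tail G e" and "awalk (head G e) p w"
    by (auto simp: awalk_Cons_iff)
  with Cons obtain q where q: "awalk w q (head G e)" "length q = length p"
    by blast
  obtain e' where e': "e' \<in> arcs G" "tail G e = head G e'" "head G e = tail G e'"
    using sym_arcs e unfolding symmetric_conv by blast
  have "awalk w (q @ [e']) u"
    using q(1) arc_implies_awalk[OF e'(1)] e e' by (auto intro: awalk_appendI)
  with q(2) show ?case by (intro exI[of _ "q @ [e']"]) simp
qed

lemma (in wf_digraph) awalk_cost_unit: "awalk_cost (\<lambda>_. 1) p = real (length p)"
  by (induct p) auto

text \<open>Reversing walks shows that both infima range over the same set of costs. If no walk
  exists, both sets are empty, so the equality covers arbitrary \<open>u\<close> and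
  \<open>w\<close>.\<close>

lemma (in sym_digraph) unit_dist_commute: "\<mu> (\<lambda>_. 1) u w = \<mu> (\<lambda>_. 1) w u"
proof -
  have "(\<lambda>p. ereal (awalk_cost (\<lambda>_. 1) p)) ` {p. awalk x p y}
      \<subseteq> (\<lambda>p. ereal (awalk_cost (\<lambda>_. 1) p)) ` {p. awalk y p x}" for x y
  proof (clarsimp simp: awalk_cost_unit)
    fix p assume "awalk x p y"
    from reverse_awalk[OF this]
    show "ereal (real (length p)) \<in> (\<lambda>p. ereal (real (length p))) ` {p. awalk y p x}"
      by (metis (mono_tags, lifting) image_eqI mem_Collect_eq)
  qed
  then show ?thesis
    unfolding \<mu>_def by (metis subset_antisym)
qed

lemma (in wf_digraph) unit_dist_self:
  assumes "u \<in> verts G"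
  shows "\<mu> (\<lambda>_. 1) u u = 0"
proof (rule antisym)
  show "\<mu> (\<lambda>_. 1) u u \<le> 0"
    \<comment> \<open>The witness is the empty walk, which is a walk at \<open>u\<close> because
      \<open>u\<close> is a vertex.\<close>
    using min_cost_le_walk_cost[of u "[]" u "\<lambda>_. 1"] assms
    by (simp add: awalk_Nil_iff zero_ereal_def)
  show "0 \<le> \<mu> (\<lambda>_. 1) u u"
    unfolding \<mu>_def by (rule INF_greatest) (simp add: awalk_cost_unit)
qed

section \<open>Eigenvalues\<close>

lemma order_prod_linear_factors:
  fixes k :: "'a :: field"
  shows "order k (\<Prod>a\<leftarrow>es. [:- a, 1:]) = count_list es k"
proof (induct es)
  case Nil
  then show ?case by (simp add: order_0I)
next
  case (Cons a es)
  have nz: "(\<Prod>a\<leftarrow>es. [:- a, 1:]) \<noteq> (0 :: 'a poly)"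
    by (auto simp: prod_list_zero_iff)
  have "order k [:- a, 1:] = (if a = k then 1 else 0)"
    using order_power_n_n[of k 1] by (auto intro: order_0I)
  then show ?case
    using Cons nz by (simp add: order_mult del: mult_pCons_left)
qed

lemma sum_list_map_eq_sum_of_nat_count:
  fixes f :: "'a \<Rightarrow> 'b :: comm_semiring_1"
  shows "sum_list (map f xs) = (\<Sum>x\<in>set xs. of_nat (count_list xs x) * f x)"
proof -
  \<comment> \<open>A fixed finite superset \<open>X\<close> of \<open>set xs\<close> keeps the
    index set unchanged during the induction on the list.\<close>
  have "sum_list (map f xs) = (\<Sum>x\<in>X. of_nat (count_list xs x) * f x)"
    if "finite X" "set xs \<subseteq> X" for X
    using that(2)
  proof (induct xs)
    case (Cons a xs)
    have "(\<Sum>x\<in>X. of_nat (count_list (a # xs) x) * f x)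
        = (\<Sum>x\<in>X. (if a = x then f x else 0) + of_nat (count_list xs x) * f x)"
      by (intro sum.cong) (auto simp: distrib_right)
    then show ?case
      using Cons that(1) by (simp add: sum.distrib)
  qed simp
  then show ?thesis by simp
qed

text \<open>Passing from distinct eigenvalues with multiplicities to positions in a list makes the
  inequalities for finite sequences applicable.\<close>

lemma matrix_energy_conv_sum_list:
  assumes A: "A \<in> carrier_mat n n"
    and es: "char_poly (map_mat complex_of_real A) = (\<Prod>a\<leftarrow>es. [:- a, 1:])"
  shows "matrix_energy A = sum_list (map cmod es)"
proof -
  let ?B = "map_mat complex_of_real A"
  have B: "?B \<in> carrier_mat n n" using A by simp
  have "spectrum ?B = set es"
    unfolding spectrum_root_char_poly[OF B] es by (auto simp: poly_prod_list prod_list_zero_iff)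
  then show ?thesis
    unfolding matrix_energy_def Let_def es order_prod_linear_factors
    by (simp add: sum_list_map_eq_sum_of_nat_count)
qed

section \<open>Traces and Schur triangularisation\<close>

definition mat_trace :: "'a :: comm_monoid_add mat \<Rightarrow> 'a" where
  "mat_trace A = (\<Sum>i<dim_row A. A $$ (i, i))"

lemma mat_trace_mult_commute:
  fixes A B :: "'a :: comm_semiring_0 mat"
  assumes A: "A \<in> carrier_mat n m" and B: "B \<in> carrier_mat m n"
  shows "mat_trace (A * B) = mat_trace (B * A)"
proof -
  have "mat_trace (A * B) = (\<Sum>i<n. \<Sum>j<m. A $$ (i, j) * B $$ (j, i))"
    using A B by (simp add: mat_trace_def scalar_prod_def atLeast0LessThan)
  also have "\<dots> = (\<Sum>j<m. \<Sum>i<n. B $$ (j, i) * A $$ (i, j))"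
    by (subst sum.swap) (simp add: mult.commute)
  also have "\<dots> = mat_trace (B * A)"
    using A B by (simp add: mat_trace_def scalar_prod_def atLeast0LessThan)
  finally show ?thesis .
qed

text \<open>Commuting the factors under the trace moves \<open>Q\<close> next to \<open>P\<close>,
  where the two cancel.\<close>

lemma similar_mat_trace:
  fixes A B :: "'a :: comm_semiring_1 mat"
  assumes "similar_mat A B"
  shows "mat_trace A = mat_trace B"
proof -
  from similar_matD[OF assms] obtain n P Q
    where c: "{A, B, P, Q} \<subseteq> carrier_mat n n" and QP: "Q * P = 1\<^sub>m n" and A: "A = P * B * Q"
    by blast
  have "mat_trace A = mat_trace (Q * (P * B))"
    unfolding A using c by (intro mat_trace_mult_commute[of _ n n]) auto
  also have "Q * (P * B) = B"
    using c QP left_mult_one_mat[of B n n] by (simp flip: assoc_mult_mat[of Q n n P n B n])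
  finally show ?thesis .
qed

text \<open>For \<open>i \<noteq> j\<close>, one of the positions \<open>(i, j)\<close> and
  \<open>(j, i)\<close> lies below the diagonal, so only the squares of diagonal entries
  survive.\<close>

lemma mat_trace_square_upper_triangular:
  fixes B :: "'a :: comm_ring_1 mat"
  assumes B: "B \<in> carrier_mat n n" and ut: "upper_triangular B"
  shows "mat_trace (B * B) = sum_list (map (\<lambda>x. x\<^sup>2) (diag_mat B))"
proof -
  have z: "(\<Sum>j<n. B $$ (i, j) * B $$ (j, i)) = (B $$ (i, i))\<^sup>2" if "i < n" for i
  proof -
    have "(\<Sum>j<n. B $$ (i, j) * B $$ (j, i)) = (\<Sum>j<n. if j = i then (B $$ (i, i))\<^sup>2 else 0)"
    proof (rule sum.cong)
      fix j assume "j \<in> {..<n}"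
      then show "B $$ (i, j) * B $$ (j, i) = (if j = i then (B $$ (i, i))\<^sup>2 else 0)"
        using upper_triangularD[OF ut, of i j] upper_triangularD[OF ut, of j i] B that
        by (cases i j rule: linorder_cases) (auto simp: power2_eq_square)
    qed simp
    then show ?thesis using that by simp
  qed
  show ?thesis
    using B z by (simp add: mat_trace_def scalar_prod_def atLeast0LessThan diag_mat_def
        interv_sum_list_conv_sum_set_nat comp_def)
qed

text \<open>Schur decomposition gives an upper triangular matrix similar to \<open>A\<close> with
  diagonal \<open>es\<close>. Its square is similar to \<open>A * A\<close>, and trace and
  determinant are invariant under similarity.\<close>

lemma sum_squares_eigenvalues:
  fixes A :: "complex mat"
  assumes A: "A \<in> carrier_mat n n" and es: "char_poly A = (\<Prod>a\<leftarrow>es. [:- a, 1:])"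
  shows "sum_list (map (\<lambda>x. x\<^sup>2) es) = mat_trace (A * A)" "det A = prod_list es"
proof -
  obtain B P Q where schur: "schur_decomposition A es = (B, P, Q)"
    by (cases "schur_decomposition A es") auto
  from schur_decomposition[OF A es this]
  have sim: "similar_mat_wit A B P Q" and ut: "upper_triangular B" and diag: "diag_mat B = es"
    by auto
  have B: "B \<in> carrier_mat n n"
    using similar_mat_witD2[OF A sim] by simp
  have "similar_mat (A ^\<^sub>m 2) (B ^\<^sub>m 2)"
    using similar_mat_wit_pow[OF sim] unfolding similar_mat_def by blast
  then have "similar_mat (A * A) (B * B)"
    using A B by (simp add: numeral_2_eq_2)
  then show "sum_list (map (\<lambda>x. x\<^sup>2) es) = mat_trace (A * A)"
    using similar_mat_trace mat_trace_square_upper_triangular[OF B ut] diag by metis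
  have "similar_mat A B" using sim unfolding similar_mat_def by blast
  then show "det A = prod_list es"
    using det_similar det_upper_triangular[OF ut B] diag by metis
qed

lemma eigenvalue_symmetric_real:
  assumes A: "A \<in> carrier_mat n n"
    and sym: "\<And>i j. i < n \<Longrightarrow> j < n \<Longrightarrow> A $$ (i, j) = A $$ (j, i)"
    and k: "eigenvalue (map_mat complex_of_real A) k"
  shows "k \<in> \<real>"
proof -
  let ?B = "map_mat complex_of_real A"
  from k obtain x where x: "x \<in> carrier_vec n" "x \<noteq> 0\<^sub>v n" and Bx: "?B *\<^sub>v x = k \<cdot>\<^sub>v x"
    using A unfolding eigenvalue_def eigenvector_def by auto
  \<comment> \<open>\<open>s\<close> is the squared norm of the eigenvector and \<open>q\<close> the
    Hermitian form of the matrix at it. Once \<open>q = k * s\<close> is known, it remains that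
    \<open>q\<close> is real and \<open>s\<close> is real and nonzero.\<close>
  define s where "s = (\<Sum>i<n. cnj (x $ i) * x $ i)"
  define q where "q = (\<Sum>i<n. \<Sum>j<n. cnj (x $ i) * (of_real (A $$ (i, j)) * x $ j))"
  have "(\<Sum>j<n. of_real (A $$ (i, j)) * x $ j) = k * x $ i" if "i < n" for i
    using arg_cong[OF Bx, of "\<lambda>v. v $ i"] A x that
    by (simp add: scalar_prod_def atLeast0LessThan)
  then have q1: "q = k * s"
    unfolding q_def s_def sum_distrib_left
    by (intro sum.cong) (simp_all flip: sum_distrib_left add: mult.left_commute)
  have "cnj q = (\<Sum>i<n. \<Sum>j<n. x $ i * (of_real (A $$ (i, j)) * cnj (x $ j)))"
    unfolding q_def by simp
  \<comment> \<open>Exchanging the two summations and using symmetry of \<open>A\<close> undoes the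
    conjugation.\<close>
  also have "\<dots> = q"
    unfolding q_def by (subst sum.swap, intro sum.cong) (simp_all add: sym mult_ac)
  finally have q2: "cnj q = q" .
  have s: "s = of_real (\<Sum>i<n. (cmod (x $ i))\<^sup>2)"
    unfolding s_def of_real_sum complex_norm_square by (simp add: mult.commute)
  obtain i where i: "i < n" "x $ i \<noteq> 0"
    using x by (metis carrier_vecD eq_vecI index_zero_vec)
  then have "0 < (\<Sum>i<n. (cmod (x $ i))\<^sup>2)"
    by (intro sum_pos2[of _ i]) auto
  with s have "s \<noteq> 0" "cnj s = s" by (simp_all only: of_real_eq_0_iff complex_cnj_complex_of_real)
  with q1 q2 show ?thesis
    by (simp add: Reals_cnj_iff)
qed

section \<open>Inequalities between means\<close>

text \<open>Each index is the first component of \<open>n - 1\<close> pairs and, by swapping, the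
  second component of as many. For \<open>n = 0\<close> the truncated exponent is 0 and both sides
  are 1.\<close>

lemma prod_off_diagonal_pairs:
  fixes x :: "nat \<Rightarrow> 'a :: comm_semiring_1"
  shows "(\<Prod>(i, j)\<in>Sigma {..<n} (\<lambda>i. {..<n} - {i}). x i * x j) = (\<Prod>i<n. x i) ^ (2 * (n - 1))"
proof -
  let ?S = "Sigma {..<n} (\<lambda>i. {..<n} - {i})"
  have fst: "(\<Prod>(i, j)\<in>?S. x i) = (\<Prod>i<n. x i) ^ (n - 1)"
    by (simp flip: prod.Sigma add: prod_power_distrib)
  have "(\<Prod>(i, j)\<in>?S. x j) = (\<Prod>(i, j)\<in>?S. x i)"
    by (rule prod.reindex_bij_witness[of _ prod.swap prod.swap]) auto
  with fst show ?thesis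
    by (simp add: prod.distrib split_def flip: power_add mult_2)
qed

lemma sum_squared_split:
  fixes x :: "nat \<Rightarrow> 'a :: comm_ring_1"
  shows "(\<Sum>i<n. x i)\<^sup>2
    = (\<Sum>i<n. (x i)\<^sup>2) + (\<Sum>(i, j)\<in>Sigma {..<n} (\<lambda>i. {..<n} - {i}). x i * x j)"
proof -
  have "(\<Sum>i<n. x i)\<^sup>2 = (\<Sum>i<n. \<Sum>j<n. x i * x j)"
    by (simp add: power2_eq_square sum_product)
  also have "\<dots> = (\<Sum>i<n. (x i)\<^sup>2 + (\<Sum>j\<in>{..<n} - {i}. x i * x j))"
    by (intro sum.cong) (simp_all add: sum.remove power2_eq_square)
  finally show ?thesis
    by (simp add: sum.distrib sum.Sigma)
qed

lemma sum_squared_ge_geometric_mean: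
  fixes x :: "nat \<Rightarrow> real"
  assumes nonneg: "\<And>i. i < n \<Longrightarrow> 0 \<le> x i"
  shows "(\<Sum>i<n. (x i)\<^sup>2) + real n * (real n - 1) * (\<Prod>i<n. x i) powr (2 / real n)
    \<le> (\<Sum>i<n. x i)\<^sup>2"
proof (cases "n \<le> 1")
  case True
  \<comment> \<open>There are no pairs to average here, but the factor
    \<open>real n * (real n - 1)\<close> vanishes.\<close>
  then have "n = 0 \<or> n = 1" by auto
  then show ?thesis by auto
next
  case False
  let ?S = "Sigma {..<n} (\<lambda>i. {..<n} - {i})"
  let ?P = "\<Prod>i<n. x i"
  have card: "card ?S = n * (n - 1)" by simp
  have pos: "n * (n - 1) > 0" using False by simp
  have ne: "?S \<noteq> {}" using card pos by (metis card.empty less_numeral_extra(3))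
  have P: "?P \<ge> 0" using nonneg by (intro prod_nonneg) auto
  \<comment> \<open>This is the geometric mean of the pair products. The case \<open>?P = 0\<close>
    is separate because turning \<open>^\<close> into \<open>powr\<close> requires a positive
    base.\<close>
  have r: "(?P ^ (2 * (n - 1))) powr (1 / real (n * (n - 1))) = ?P powr (2 / real n)"
  proof (cases "?P = 0")
    case True
    then show ?thesis using False by (simp add: zero_power del: prod_zero_iff)
  next
    case nz: False
    have "?P ^ (2 * (n - 1)) = ?P powr real (2 * (n - 1))"
      using nz P by (intro powr_realpow[symmetric]) linarith
    moreover have "real (2 * (n - 1)) * (1 / real (n * (n - 1))) = 2 / real n"
      using False by (simp add: field_simps)
    ultimately show ?thesis by (simp only: powr_powr)
  qed
  have "(\<Prod>p\<in>?S. x (fst p) * x (snd p)) powr (1 / card ?S)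
      \<le> (\<Sum>p\<in>?S. x (fst p) * x (snd p) / card ?S)"
    using ne nonneg by (intro arith_geom_mean) auto
  then have "?P powr (2 / real n) \<le> (\<Sum>(i, j)\<in>?S. x i * x j) / real (n * (n - 1))"
    using prod_off_diagonal_pairs[of x n] r
    by (simp add: card split_def flip: sum_divide_distrib)
  then have "real (n * (n - 1)) * ?P powr (2 / real n) \<le> (\<Sum>(i, j)\<in>?S. x i * x j)"
    using pos by (simp add: pos_le_divide_eq mult.commute)
  moreover have "real (n * (n - 1)) = real n * (real n - 1)"
    using False by (simp add: of_nat_diff)
  ultimately show ?thesis
    unfolding sum_squared_split by (simp only: add_left_mono)
qed

section \<open>Energy of symmetric matrices\<close>

lemma prod_list_cmod: "cmod (prod_list es) = prod_list (map cmod es)"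
  by (induct es) (simp_all add: norm_mult)

text \<open>\<open>F\<close> is the squared Frobenius norm, which for a symmetric matrix equals the
  trace of the square and hence the sum of the squared eigenvalues.\<close>

theorem symmetric_matrix_energy_bounds:
  fixes A :: "real mat"
  assumes A: "A \<in> carrier_mat n n"
    and sym: "\<And>i j. i < n \<Longrightarrow> j < n \<Longrightarrow> A $$ (i, j) = A $$ (j, i)"
  defines "F \<equiv> \<Sum>i<n. \<Sum>j<n. (A $$ (i, j))\<^sup>2"
  shows "sqrt (F + real n * (real n - 1) * \<bar>det A\<bar> powr (2 / real n)) \<le> matrix_energy A"
    and "matrix_energy A \<le> sqrt (real n * F)"
proof -
  let ?B = "map_mat complex_of_real A"
  have B: "?B \<in> carrier_mat n n" using A by simp
  obtain es where es: "char_poly ?B = (\<Prod>a\<leftarrow>es. [:- a, 1:])" and len: "length es = n"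
    using char_poly_factorized[OF B] by blast
  define x where "x i = cmod (es ! i)" for i
  have list_sum: "sum_list (map f es) = (\<Sum>i<n. f (es ! i))" for f :: "complex \<Rightarrow> 'c :: comm_monoid_add"
    by (simp add: sum_list_sum_nth len atLeast0LessThan)
  have energy: "matrix_energy A = (\<Sum>i<n. x i)"
    unfolding matrix_energy_conv_sum_list[OF A es] list_sum x_def ..
  have real: "es ! i \<in> \<real>" if "i < n" for i
  proof (rule eigenvalue_symmetric_real[OF A sym])
    have "es ! i \<in> set es" using that len by simp
    then show "eigenvalue ?B (es ! i)"
      unfolding eigenvalue_root_char_poly[OF B] es by (auto simp: poly_prod_list prod_list_zero_iff)
  qed
  \<comment> \<open>Realness of the eigenvalues enters here: a complex number has the same square as
    its absolute value only if it is real.\<close>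
  have "complex_of_real (\<Sum>i<n. (x i)\<^sup>2) = (\<Sum>i<n. (es ! i)\<^sup>2)"
    unfolding of_real_sum
  proof (rule sum.cong)
    fix i assume "i \<in> {..<n}"
    then obtain t where "es ! i = of_real t"
      using real by (auto elim: Reals_cases)
    then show "complex_of_real ((x i)\<^sup>2) = (es ! i)\<^sup>2"
      by (simp add: x_def flip: of_real_power)
  qed simp
  also have "\<dots> = mat_trace (?B * ?B)"
    using sum_squares_eigenvalues(1)[OF B es] by (simp add: list_sum)
  also have "\<dots> = complex_of_real F"
    using A sym by (simp add: mat_trace_def F_def scalar_prod_def atLeast0LessThan power2_eq_square)
  finally have F: "(\<Sum>i<n. (x i)\<^sup>2) = F"
    unfolding of_real_eq_iff .
  have "\<bar>det A\<bar> = cmod (det ?B)"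
    by (simp add: of_real_hom.hom_det)
  also have "\<dots> = (\<Prod>i<n. x i)"
    unfolding sum_squares_eigenvalues(2)[OF B es] prod_list_cmod
    by (simp add: prod.list_conv_set_nth len atLeast0LessThan x_def)
  finally have det: "\<bar>det A\<bar> = (\<Prod>i<n. x i)" .
  have x: "x i \<ge> 0" for i by (simp add: x_def)
  show "sqrt (F + real n * (real n - 1) * \<bar>det A\<bar> powr (2 / real n)) \<le> matrix_energy A"
    unfolding det energy F[symmetric]
    using sum_squared_ge_geometric_mean[of n x] x by (intro real_le_lsqrt sum_nonneg) auto
  \<comment> \<open>Cauchy-Schwarz against the all-ones vector.\<close>
  have "(\<Sum>i<n. x i)\<^sup>2 \<le> real n * (\<Sum>i<n. (x i)\<^sup>2)"
    using sum_squared_le_sum_of_squares[of x "{..<n}"] by (simp add: mult.commute)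
  then show "matrix_energy A \<le> sqrt (real n * F)"
    unfolding energy F by (rule real_le_rsqrt)
qed

lemma sum_symmetric_off_diagonal:
  fixes f :: "nat \<Rightarrow> nat \<Rightarrow> real"
  assumes sym: "\<And>i j. i < n \<Longrightarrow> j < n \<Longrightarrow> f i j = f j i" and diag: "\<And>i. i < n \<Longrightarrow> f i i = 0"
  shows "(\<Sum>i<n. \<Sum>j<n. f i j) = 2 * (\<Sum>(i, j)\<in>{(i, j). i < j \<and> j < n}. f i j)"
proof -
  let ?U = "{(i, j). i < j \<and> j < n}" and ?L = "{(i, j). j < i \<and> i < n}" and ?D = "(\<lambda>i. (i, i)) ` {..<n}"
  \<comment> \<open>The index square splits into the strict upper triangle, its mirror image and the
    diagonal.\<close>
  have un: "{..<n} \<times> {..<n} = (?U \<union> ?L) \<union> ?D" by auto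
  have fin: "finite ?U" "finite ?L"
    by (rule finite_subset[of _ "{..<n} \<times> {..<n}"]; auto)+
  have "(\<Sum>i<n. \<Sum>j<n. f i j) = (\<Sum>(i, j)\<in>{..<n} \<times> {..<n}. f i j)"
    by (simp add: sum.cartesian_product)
  also have "\<dots> = (\<Sum>(i, j)\<in>?U. f i j) + (\<Sum>(i, j)\<in>?L. f i j) + (\<Sum>(i, j)\<in>?D. f i j)"
    unfolding un using fin by (subst sum.union_disjoint; (subst sum.union_disjoint)?) auto
  also have "(\<Sum>(i, j)\<in>?D. f i j) = 0"
    using diag by (intro sum.neutral) auto
  also have "(\<Sum>(i, j)\<in>?L. f i j) = (\<Sum>(i, j)\<in>?U. f i j)"
    by (rule sum.reindex_bij_witness[of _ prod.swap prod.swap]) (auto intro: sym)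
  finally show ?thesis by simp
qed

section \<open>Application to the distance Seidel matrix\<close>

theorem theorem5p6:
  fixes G :: "('a, 'b) pre_digraph" and n :: nat and v :: "nat \<Rightarrow> 'a" and T :: real
  assumes "graph G"
    and "Digraph_Component.connected G"
    and "card (verts G) = n"
    and "bij_betw v {0..<n} (verts G)"
    and "T = (\<Sum>(r, t)\<in>{(r, t). r < t \<and> t < n}. (1 - 2 * graph_dist G (v r) (v t))\<^sup>2)"
  shows "sqrt (2 * T + real n * (real n - 1) *
             \<bar>det (distance_Seidel_matrix G n v)\<bar> powr (2 / real n))
           \<le> distance_Seidel_energy G n v
         \<and> distance_Seidel_energy G n v \<le> sqrt (2 * real n * T)"
proof -
  interpret graph G by fact
  let ?S = "distance_Seidel_matrix G n v"
  have S: "?S \<in> carrier_mat n n"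
    by (rule carrier_matI)
      (simp_all add: distance_Seidel_matrix_def all_ones_matrix_def distance_matrix_def)
  have entry: "?S $$ (i, j) = (if i = j then 0 else 1 - 2 * graph_dist G (v i) (v j))"
    if "i < n" "j < n" for i j
  proof -
    \<comment> \<open>On the diagonal the entry is \<open>1 - 1 - 2 * 0\<close>, once a vertex is
      known to be at distance 0 from itself.\<close>
    have "v i \<in> verts G"
      using assms(4) that by (auto simp: bij_betw_def)
    then have "graph_dist G (v i) (v i) = 0"
      by (simp add: graph_dist_def unit_dist_self)
    then show ?thesis
      using that by (auto simp: distance_Seidel_matrix_def all_ones_matrix_def distance_matrix_def)
  qed
  have commute: "graph_dist G u w = graph_dist G w u" for u w
    unfolding graph_dist_def by (subst unit_dist_commute) simp
  have sym: "?S $$ (i, j) = ?S $$ (j, i)" if "i < n" "j < n" for i j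
    using that by (simp add: entry commute)
  \<comment> \<open>Each unordered pair of distinct indices contributes two equal entries, so the
    squared Frobenius norm is \<open>2 * T\<close>.\<close>
  have "(\<Sum>i<n. \<Sum>j<n. (?S $$ (i, j))\<^sup>2)
      = 2 * (\<Sum>(i, j)\<in>{(i, j). i < j \<and> j < n}. (?S $$ (i, j))\<^sup>2)"
    by (rule sum_symmetric_off_diagonal) (simp_all add: sym entry)
  also have "(\<Sum>(i, j)\<in>{(i, j). i < j \<and> j < n}. (?S $$ (i, j))\<^sup>2) = T"
    unfolding assms(5) by (intro sum.cong) (auto simp: entry)
  finally have F: "(\<Sum>i<n. \<Sum>j<n. (?S $$ (i, j))\<^sup>2) = 2 * T" .
  show ?thesis
    using symmetric_matrix_energy_bounds[OF S sym] unfolding F distance_Seidel_energy_def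
    by (simp add: mult_ac)
qed

end
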